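(* Let $\mathcal{A}$ be an arborescence with rank function $\rho$, let $x\in\mathcal{A}$ and let $n\in\mathbb{N}$. For $y\in\mathcal{A}$ write $y\gtrdot x$ for "$y$ covers $x$". Then \[ b(x,n)=\sum_{i=n}^{\rho(x)}\ \prod_{y\gtrdot x} b(y,i).\]
   Context: $\mathbb{N}$ contains $0$. An empty sum is $0$ and an empty product is $1$. Arborescence: a finite poset $\mathcal{A}$ whose Hasse diagram (the graph of covering relations) is a rooted tree whose root is the unique minimal element $\bot$, equipped with the rank function $\rho\colon\mathcal{A}\to\mathbb{N}$ sending $x$ to the number of edges in the unique path in the Hasse diagram from $\bot$ to $x$. $y$ covers $x$ if $x<y$ and there is no $z$ with $x<z<y$. For $x\in\mathcal{A}$ let $x^{\uparrow}=\{y\in\mathcal{A}\mid x\leq y\}$. For $n\in\mathbb{N}$ let $B(x,n)$ be the set of order-preserving functions $\sigma\colon x^{\uparrow}\to\mathbb{N}$ such that $\sigma(y)\leq\rho(y)$ for all $y\in x^{\uparrow}$ and $\sigma(x)\geq n$. Let $b(x,n)$ be the cardinality of $B(x,n)$. *)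

theory Defs
  imports Main "HOL-Library.FuncSet"
begin

text \<open>
  A poset is given by a carrier \<open>A\<close> and a relation \<open>r\<close> with \<^prop>\<open>partial_order_on A r\<close>, where
  \<^prop>\<open>(x, y) \<in> r\<close> means \<open>x \<le> y\<close>.
\<close>

definition covers :: "'a set \<Rightarrow> 'a rel \<Rightarrow> 'a \<Rightarrow> 'a \<Rightarrow> bool" where
  "covers A r y x \<longleftrightarrow>
     x \<in> A \<and> y \<in> A \<and> (x, y) \<in> r \<and> x \<noteq> y \<and>
     \<not> (\<exists>z\<in>A. (x, z) \<in> r \<and> x \<noteq> z \<and> (z, y) \<in> r \<and> z \<noteq> y)"

definition minimal_elt :: "'a set \<Rightarrow> 'a rel \<Rightarrow> 'a \<Rightarrow> bool" where
  "minimal_elt A r x \<longleftrightarrow> x \<in> A \<and> (\<forall>y\<in>A. (y, x) \<in> r \<longrightarrow> y = x)"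

definition hasse_edges :: "'a set \<Rightarrow> 'a rel \<Rightarrow> 'a set set" where
  "hasse_edges A r = {{x, y} | x y. covers A r y x}"

text \<open>
  Undirected simple graphs with vertex set \<open>V\<close> and edge set \<open>E\<close>, an edge being the set of its two
  ends.  (The predicate \<open>tree\<close> of \<open>Graph_Theory.Digraph_Component\<close> forbids only directed
  cycles, and a Hasse diagram oriented by \<open>r\<close> has none of these.)
\<close>

definition graph_path :: "'a set \<Rightarrow> 'a set set \<Rightarrow> 'a \<Rightarrow> 'a list \<Rightarrow> 'a \<Rightarrow> bool" where
  "graph_path V E u p v \<longleftrightarrow>
     p \<noteq> [] \<and> hd p = u \<and> last p = v \<and> set p \<subseteq> V \<and> distinct p \<and>
     successively (\<lambda>a b. {a, b} \<in> E) p"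

definition graph_cycle :: "'a set \<Rightarrow> 'a set set \<Rightarrow> 'a list \<Rightarrow> bool" where
  "graph_cycle V E p \<longleftrightarrow>
     length p \<ge> 3 \<and> set p \<subseteq> V \<and> distinct p \<and>
     successively (\<lambda>a b. {a, b} \<in> E) p \<and> {last p, hd p} \<in> E"

definition graph_tree :: "'a set \<Rightarrow> 'a set set \<Rightarrow> bool" where
  "graph_tree V E \<longleftrightarrow>
     V \<noteq> {} \<and> (\<forall>u\<in>V. \<forall>v\<in>V. \<exists>p. graph_path V E u p v) \<and> \<not> (\<exists>p. graph_cycle V E p)"

definition arborescence :: "'a set \<Rightarrow> 'a rel \<Rightarrow> 'a \<Rightarrow> bool" where
  "arborescence A r rt \<longleftrightarrow>
     finite A \<and> partial_order_on A r \<and> graph_tree A (hasse_edges A r) \<and>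
     (\<forall>x. minimal_elt A r x \<longleftrightarrow> x = rt)"

text \<open>A path with \<open>k\<close> vertices has \<open>k - 1\<close> edges.\<close>

definition rank :: "'a set \<Rightarrow> 'a rel \<Rightarrow> 'a \<Rightarrow> 'a \<Rightarrow> nat" where
  "rank A r rt x = length (THE p. graph_path A (hasse_edges A r) rt p x) - 1"

definition up_set :: "'a set \<Rightarrow> 'a rel \<Rightarrow> 'a \<Rightarrow> 'a set" where
  "up_set A r x = {y \<in> A. (x, y) \<in> r}"

text \<open>
  Functions with domain \<^term>\<open>up_set A r x\<close> are extensional functions, so that each of them
  is counted once.
\<close>

definition B_fun :: "'a set \<Rightarrow> 'a rel \<Rightarrow> 'a \<Rightarrow> 'a \<Rightarrow> nat \<Rightarrow> ('a \<Rightarrow> nat) set" where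
  "B_fun A r rt x n =
     {\<sigma> \<in> up_set A r x \<rightarrow>\<^sub>E (UNIV :: nat set).
        monotone_on (up_set A r x) (\<lambda>y z. (y, z) \<in> r) (\<le>) \<sigma> \<and>
        (\<forall>y\<in>up_set A r x. \<sigma> y \<le> rank A r rt y) \<and> \<sigma> x \<ge> n}"

definition b_num :: "'a set \<Rightarrow> 'a rel \<Rightarrow> 'a \<Rightarrow> 'a \<Rightarrow> nat \<Rightarrow> nat" where
  "b_num A r rt x n = card (B_fun A r rt x n)"

end

theory Submission
  imports Defs
begin

text \<open>
  The rank function enters only as a pointwise upper bound. An element of \<open>B(x,n)\<close> amounts to its
  value \<open>i\<close> at \<open>x\<close> together with its restrictions to the up-sets of the covers \<open>y\<close> of \<open>x\<close>, each
  of which lies in \<open>B(y,i)\<close>. These restrictions are independent because the up-sets of two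
  different covers of \<open>x\<close> are disjoint: for a minimal common upper bound \<open>z\<close> of the two covers,
  saturated chains from them to \<open>z\<close> would meet in \<open>z\<close> only and close up, through \<open>x\<close>, to a cycle
  of the Hasse diagram.
\<close>

section \<open>Covers and minimal elements in finite posets\<close>

lemma coversD:
  assumes "covers A r y x"
  shows "x \<in> A" "y \<in> A" "(x, y) \<in> r" "x \<noteq> y"
  using assms by (auto simp: covers_def)

lemma partial_order_onD:
  assumes "partial_order_on A r"
  shows "\<And>a. a \<in> A \<Longrightarrow> (a, a) \<in> r"
    and "\<And>a b c. (a, b) \<in> r \<Longrightarrow> (b, c) \<in> r \<Longrightarrow> (a, c) \<in> r"
    and "\<And>a b. (a, b) \<in> r \<Longrightarrow> (b, a) \<in> r \<Longrightarrow> a = b"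
    and "\<And>a b. (a, b) \<in> r \<Longrightarrow> a \<in> A \<and> b \<in> A"
  using assms
  unfolding partial_order_on_def preorder_on_def refl_on_def trans_def antisym_def by blast+

lemma finite_has_minimal_rel:
  assumes "finite S" "S \<noteq> {}" and po: "partial_order_on A r"
  obtains m where "m \<in> S" "\<And>w. w \<in> S \<Longrightarrow> (w, m) \<in> r \<Longrightarrow> w = m"
proof -
  note pos = partial_order_onD[OF po]
  have "\<exists>m\<in>S. \<forall>w\<in>S. (w, m) \<in> r \<longrightarrow> w = m"
    using assms(1,2)
  proof (induction rule: finite_ne_induct)
    case (insert a F)
    then obtain m where m: "m \<in> F" "\<forall>w\<in>F. (w, m) \<in> r \<longrightarrow> w = m" by blast
    show ?case
      using m pos by (metis insert_iff)
  qed auto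
  then show thesis using that by blast
qed

text \<open>The cover is a minimal element of the set of elements strictly above \<open>a\<close>
  and below or equal to \<open>b\<close>, which is finite and contains \<open>b\<close>.\<close>

lemma exists_cover_below:
  assumes "finite A" and po: "partial_order_on A r" and "(a, b) \<in> r" "a \<noteq> b"
  obtains c where "covers A r c a" "(c, b) \<in> r"
proof -
  note pos = partial_order_onD[OF po]
  let ?S = "{w \<in> A. (a, w) \<in> r \<and> a \<noteq> w \<and> (w, b) \<in> r}"
  have "b \<in> ?S" using assms pos by blast
  then obtain c where c: "c \<in> ?S" "\<And>w. w \<in> ?S \<Longrightarrow> (w, c) \<in> r \<Longrightarrow> w = c"
    using finite_has_minimal_rel[of ?S A r] assms by auto
  have "covers A r c a"
    unfolding covers_def using c pos by (smt (verit) mem_Collect_eq)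
  with c that show thesis by blast
qed

section \<open>Saturated chains and cycles of the Hasse diagram\<close>

definition saturated_chain :: "'a set \<Rightarrow> 'a rel \<Rightarrow> 'a \<Rightarrow> 'a list \<Rightarrow> 'a \<Rightarrow> bool" where
  "saturated_chain A r a p b \<longleftrightarrow>
     p \<noteq> [] \<and> hd p = a \<and> last p = b \<and> distinct p \<and>
     set p \<subseteq> {w \<in> A. (a, w) \<in> r \<and> (w, b) \<in> r} \<and> successively (\<lambda>u v. covers A r v u) p"

text \<open>Induction on the size of the interval from \<open>a\<close> to \<open>b\<close>: step to
  a cover \<open>c\<close> of \<open>a\<close> below \<open>b\<close> and prepend \<open>a\<close>
  to a chain from \<open>c\<close>.\<close>

lemma saturated_chain_exists:
  assumes "finite A" and po: "partial_order_on A r" and "(a, b) \<in> r"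
  shows "\<exists>p. saturated_chain A r a p b"
  using assms(3)
proof (induction "card {w \<in> A. (a, w) \<in> r \<and> (w, b) \<in> r}" arbitrary: a rule: less_induct)
  case less
  note pos = partial_order_onD[OF po]
  have ab: "a \<in> A" "b \<in> A" using pos less.prems by metis+
  show ?case
  proof (cases "a = b")
    case True
    then have "saturated_chain A r a [a] b"
      using ab pos by (auto simp: saturated_chain_def)
    then show ?thesis by blast
  next
    case False
    then obtain c where c: "covers A r c a" "(c, b) \<in> r"
      using exists_cover_below[OF assms(1) po less.prems] by blast
    note ca = coversD[OF c(1)]
    have "{w \<in> A. (c, w) \<in> r \<and> (w, b) \<in> r} \<subset> {w \<in> A. (a, w) \<in> r \<and> (w, b) \<in> r}"
    proof (rule psubsetI)
      show "{w \<in> A. (c, w) \<in> r \<and> (w, b) \<in> r} \<subseteq> {w \<in> A. (a, w) \<in> r \<and> (w, b) \<in> r}"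
        using ca pos by blast
      \<comment> \<open>The element \<open>a\<close> itself separates the two intervals, so the
        inclusion is strict.\<close>
      have "(c, a) \<notin> r" using ca pos by metis
      moreover have "(a, a) \<in> r" using ca pos by metis
      ultimately show "{w \<in> A. (c, w) \<in> r \<and> (w, b) \<in> r} \<noteq> {w \<in> A. (a, w) \<in> r \<and> (w, b) \<in> r}"
        using ab less.prems by blast
    qed
    then have "card {w \<in> A. (c, w) \<in> r \<and> (w, b) \<in> r} < card {w \<in> A. (a, w) \<in> r \<and> (w, b) \<in> r}"
      using assms(1) by (intro psubset_card_mono) auto
    then obtain p where p: "saturated_chain A r c p b"
      using less.hyps c(2) by blast
    \<comment> \<open>All of \<open>p\<close> lies above \<open>c\<close>, so \<open>a\<close> does
      not occur in \<open>p\<close> and prepending it keeps the list distinct.\<close>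
    have "(c, a) \<notin> r" "(a, a) \<in> r" using ca pos by metis+
    moreover have "(a, w) \<in> r" if "(c, w) \<in> r" for w using ca that pos by metis
    ultimately have "saturated_chain A r a (a # p) b"
      using p ab c less.prems unfolding saturated_chain_def
      by (auto simp: successively_Cons)
    then show ?thesis by blast
  qed
qed

text \<open>Acyclicity of the Hasse diagram is exploited here; it makes the choices above different
  covers independent, which is what yields a product.\<close>

lemma up_sets_covers_disjoint:
  assumes "finite A" and po: "partial_order_on A r"
    and acyclic: "\<not> (\<exists>p. graph_cycle A (hasse_edges A r) p)"
    and y1: "covers A r y1 x" and y2: "covers A r y2 x" and "y1 \<noteq> y2"
  shows "up_set A r y1 \<inter> up_set A r y2 = {}"
proof (rule ccontr)
  assume ne: "\<not> ?thesis"
  note pos = partial_order_onD[OF po]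
  note c1 = coversD[OF y1] and c2 = coversD[OF y2]
  let ?S = "up_set A r y1 \<inter> up_set A r y2"
  obtain z where z: "z \<in> ?S" and zmin: "\<And>w. w \<in> ?S \<Longrightarrow> (w, z) \<in> r \<Longrightarrow> w = z"
    using finite_has_minimal_rel[of ?S A r] assms(1) po ne by (auto simp: up_set_def)
  \<comment> \<open>Otherwise one cover would lie strictly between \<open>x\<close> and the
    other.\<close>
  have inc: "(y1, y2) \<notin> r" "(y2, y1) \<notin> r"
    using y1 y2 \<open>y1 \<noteq> y2\<close> unfolding covers_def by blast+
  have yz: "(y1, z) \<in> r" "(y2, z) \<in> r" "y1 \<noteq> z" "y2 \<noteq> z"
    using z inc by (auto simp: up_set_def)
  obtain p q where p: "saturated_chain A r y1 p z" and q: "saturated_chain A r y2 q z"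
    using saturated_chain_exists[OF assms(1) po] yz by metis
  \<comment> \<open>Both chains end in \<open>z\<close>; dropping it from \<open>q\<close> lets the
    cycle visit it once.\<close>
  define q' where "q' = butlast q"
  have q_eq: "q = q' @ [z]"
    using q by (auto simp: q'_def saturated_chain_def)
  have "q' \<noteq> []"
    using q yz by (auto simp: q_eq saturated_chain_def)
  have E: "{u, v} \<in> hasse_edges A r" if "covers A r v u \<or> covers A r u v" for u v
    using that by (auto simp: hasse_edges_def insert_commute)
  have xp: "x \<notin> set p" "x \<notin> set q'"
    using p q c1(3,4) c2(3,4) pos(3) unfolding saturated_chain_def q_eq by fastforce+
  have disj: "set p \<inter> set q' = {}"
  proof -
    \<comment> \<open>Chains stay inside their intervals, so a shared \<open>w\<close> is a common
      upper bound of both covers below \<open>z\<close>, and minimality of \<open>z\<close>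
      applies.\<close>
    have "w = z" if "w \<in> set p" "w \<in> set q'" for w
      using that p q zmin unfolding saturated_chain_def q_eq up_set_def by auto
    moreover have "z \<notin> set q'" using q by (auto simp: q_eq saturated_chain_def)
    ultimately show ?thesis by blast
  qed
  have sp: "successively (\<lambda>a b. {a, b} \<in> hasse_edges A r) p"
    using p unfolding saturated_chain_def by (auto elim: successively_mono intro: E)
  have sq: "successively (\<lambda>a b. {a, b} \<in> hasse_edges A r) (rev q)"
    using q unfolding saturated_chain_def by (auto elim: successively_mono intro: E)
  have hds: "p \<noteq> []" "hd p = y1" "last p = z" "hd q' = y2"
    using p q \<open>q' \<noteq> []\<close> by (auto simp: saturated_chain_def q_eq)
  \<comment> \<open>Up from \<open>x\<close> through \<open>y1\<close> to \<open>z\<close>, then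
    down to \<open>y2\<close>; the closing edge joins \<open>y2\<close> to \<open>x\<close>. Length
    at least 3 holds because \<open>p\<close> and \<open>q'\<close> are nonempty.\<close>
  have "graph_cycle A (hasse_edges A r) (x # p @ rev q')"
    unfolding graph_cycle_def
  proof (intro conjI)
    show "3 \<le> length (x # p @ rev q')"
      using hds \<open>q' \<noteq> []\<close> by (cases p; cases q') auto
    show "set (x # p @ rev q') \<subseteq> A"
      using p q c1 by (auto simp: saturated_chain_def q_eq)
    show "distinct (x # p @ rev q')"
      using p q xp disj by (auto simp: saturated_chain_def q_eq)
    show "successively (\<lambda>a b. {a, b} \<in> hasse_edges A r) (x # p @ rev q')"
      using sp sq hds \<open>q' \<noteq> []\<close> E y1
      by (auto simp: q_eq successively_Cons successively_append_iff)
    show "{last (x # p @ rev q'), hd (x # p @ rev q')} \<in> hasse_edges A r"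
      using hds \<open>q' \<noteq> []\<close> E y2 by (auto simp: last_rev)
  qed
  with acyclic show False by blast
qed

section \<open>Decomposition of up-sets and of the functions on them\<close>

lemma up_set_eq_insert_covers:
  assumes "finite A" and po: "partial_order_on A r" and "x \<in> A"
  shows "up_set A r x = insert x (\<Union>y\<in>{y. covers A r y x}. up_set A r y)"
proof (intro equalityI subsetI)
  fix z assume "z \<in> up_set A r x"
  then show "z \<in> insert x (\<Union>y\<in>{y. covers A r y x}. up_set A r y)"
    using exists_cover_below[OF assms(1) po, of x z] by (auto simp: up_set_def)
next
  note pos = partial_order_onD[OF po]
  fix z assume "z \<in> insert x (\<Union>y\<in>{y. covers A r y x}. up_set A r y)"
  then show "z \<in> up_set A r x"
    using coversD(3)[of A r _ x] \<open>x \<in> A\<close> pos(1) unfolding up_set_def by (blast intro: pos(2))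
qed

text \<open>The rank bound leaves finitely many values at each point. Finiteness is required to turn
  the cardinality of a dependent sum into a sum.\<close>

lemma finite_B_fun:
  assumes "finite A"
  shows "finite (B_fun A r rt x n)"
proof (rule finite_subset)
  show "B_fun A r rt x n \<subseteq> (\<Pi>\<^sub>E y\<in>up_set A r x. {..rank A r rt y})"
    by (auto simp: B_fun_def PiE_def)
  show "finite (\<Pi>\<^sub>E y\<in>up_set A r x. {..rank A r rt y})"
    using assms by (intro finite_PiE) (auto simp: up_set_def)
qed

text \<open>The target is a dependent sum because the value \<open>i\<close> at \<open>x\<close>
  becomes the lower bound for every restriction; \<open>i\<close> ranges up to the rank bound at
  \<open>x\<close>.\<close>

lemma bij_betw_B_fun:
  assumes "finite A" and po: "partial_order_on A r"
    and acyclic: "\<not> (\<exists>p. graph_cycle A (hasse_edges A r) p)" and "x \<in> A"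
  shows "bij_betw (\<lambda>\<sigma>. (\<sigma> x, \<lambda>y\<in>{y. covers A r y x}. restrict \<sigma> (up_set A r y)))
    (B_fun A r rt x n)
    (SIGMA i:{n..rank A r rt x}. \<Pi>\<^sub>E y\<in>{y. covers A r y x}. B_fun A r rt y i)"
    (is "bij_betw ?f _ ?T")
proof -
  note pos = partial_order_onD[OF po]
  define C where "C = {y. covers A r y x}"
  define U where "U = up_set A r"
  have Ux: "U x = insert x (\<Union>y\<in>C. U y)"
    using up_set_eq_insert_covers[OF assms(1) po \<open>x \<in> A\<close>] by (simp add: C_def U_def)
  have CA: "y \<in> A" "(x, y) \<in> r" "x \<noteq> y" if "y \<in> C" for y
    using that coversD unfolding C_def by fastforce+
  have self: "y \<in> U y" if "y \<in> A" for y
    using that pos unfolding U_def up_set_def by blast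
  have xU: "x \<notin> U y" if "y \<in> C" for y
    using CA[OF that] pos unfolding U_def up_set_def by blast
  have up_closed: "w \<in> U y" if "z \<in> U y" "(z, w) \<in> r" for y z w
    using that pos unfolding U_def up_set_def by blast
  have uniq: "y = y'" if "y \<in> C" "y' \<in> C" "z \<in> U y" "z \<in> U y'" for y y' z
    using up_sets_covers_disjoint[OF assms(1) po acyclic, of y x y'] that
    unfolding C_def U_def by auto
  have B_iff: "\<sigma> \<in> B_fun A r rt y i \<longleftrightarrow> \<sigma> \<in> extensional (U y) \<and>
      (\<forall>z\<in>U y. \<forall>w\<in>U y. (z, w) \<in> r \<longrightarrow> \<sigma> z \<le> \<sigma> w) \<and>
      (\<forall>z\<in>U y. \<sigma> z \<le> rank A r rt z) \<and> i \<le> \<sigma> y" for \<sigma> y i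
    by (auto simp: B_fun_def PiE_def monotone_on_def U_def)
  have into: "?f \<sigma> \<in> ?T" if s: "\<sigma> \<in> B_fun A r rt x n" for \<sigma>
  proof -
    \<comment> \<open>The lower bound at \<open>y\<close> is monotonicity along the pair
      \<open>(x, y)\<close>.\<close>
    have "restrict \<sigma> (U y) \<in> B_fun A r rt y (\<sigma> x)" if "y \<in> C" for y
      unfolding B_iff using s[unfolded B_iff] CA[OF that] self that \<open>x \<in> A\<close> Ux by auto
    then show ?thesis
      using s[unfolded B_iff] self \<open>x \<in> A\<close> by (auto simp: C_def U_def)
  qed
  have inj: "inj_on ?f (B_fun A r rt x n)"
  proof (rule inj_onI)
    fix \<sigma> \<tau>
    assume s: "\<sigma> \<in> B_fun A r rt x n" and t: "\<tau> \<in> B_fun A r rt x n" and eq: "?f \<sigma> = ?f \<tau>"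
    show "\<sigma> = \<tau>"
    proof (rule extensionalityI)
      show "\<sigma> \<in> extensional (U x)" "\<tau> \<in> extensional (U x)"
        using s t B_iff by blast+
      fix z assume "z \<in> U x"
      then consider "z = x" | y where "y \<in> C" "z \<in> U y" using Ux by blast
      then show "\<sigma> z = \<tau> z"
      proof cases
        case 1
        then show ?thesis using eq by simp
      next
        case 2
        have "restrict \<sigma> (U y) = restrict \<tau> (U y)"
          using fun_cong[OF arg_cong[OF eq, of snd], of y] 2 by (simp add: C_def U_def)
        from fun_cong[OF this, of z] 2 show ?thesis by simp
      qed
    qed
  qed
  have surj: "\<exists>\<sigma>\<in>B_fun A r rt x n. ?f \<sigma> = (i, g)" if ig: "(i, g) \<in> ?T" for i g
  proof -
    have i: "n \<le> i" "i \<le> rank A r rt x" and g: "g \<in> extensional C"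
      and gB: "\<And>y. y \<in> C \<Longrightarrow> g y \<in> B_fun A r rt y i"
      using ig by (auto simp: C_def PiE_def)
    note gB = gB[unfolded B_iff]
    \<comment> \<open>Gluing: by \<open>uniq\<close>, a point \<open>z\<close> other than
      \<open>x\<close> belongs to the up-set of exactly one cover, and \<open>THE\<close> selects
      it.\<close>
    define \<sigma> where "\<sigma> = (\<lambda>z\<in>U x. if z = x then i else g (THE y. y \<in> C \<and> z \<in> U y) z)"
    have sx: "\<sigma> x = i" using self \<open>x \<in> A\<close> by (simp add: \<sigma>_def)
    have sy: "\<sigma> z = g y z" if "y \<in> C" "z \<in> U y" for y z
    proof -
      have "(THE y. y \<in> C \<and> z \<in> U y) = y" using that uniq by blast
      moreover have "z \<noteq> x" "z \<in> U x" using that xU Ux by auto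
      ultimately show ?thesis by (simp add: \<sigma>_def)
    qed
    have ge: "i \<le> g y z" if "y \<in> C" "z \<in> U y" for y z
    proof -
      have "(y, z) \<in> r" using that by (simp add: U_def up_set_def)
      then have "g y y \<le> g y z" using gB[OF that(1)] that self CA(1) by blast
      then show ?thesis using gB[OF that(1)] by simp
    qed
    have mono: "\<sigma> z \<le> \<sigma> w" if z: "z \<in> U x" and w: "w \<in> U x" and zw: "(z, w) \<in> r" for z w
    proof -
      \<comment> \<open>Comparable points never lie in different branches, since each
        \<open>U y\<close> is upward closed; pairs starting at \<open>x\<close> are handled by
        \<open>ge\<close>.\<close>
      consider "z = x" "w = x" | y where "z = x" "y \<in> C" "w \<in> U y" | y where "y \<in> C" "z \<in> U y"
        using z w unfolding Ux by blast
      then show ?thesis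
      proof cases
        case 2
        then show ?thesis using sx sy ge by simp
      next
        case 3
        then have "w \<in> U y" using up_closed zw by blast
        then show ?thesis using sy 3 gB[OF 3(1)] zw by simp
      qed simp
    qed
    have bound: "\<sigma> z \<le> rank A r rt z" if z: "z \<in> U x" for z
      proof -
      consider "z = x" | y where "y \<in> C" "z \<in> U y" using z unfolding Ux by blast
      then show ?thesis using i sx sy gB by cases auto
    qed
    have "\<sigma> \<in> B_fun A r rt x n"
      unfolding B_iff using mono bound i sx by (auto simp: \<sigma>_def)
    moreover have "(\<lambda>y\<in>C. restrict \<sigma> (U y)) = g"
    proof (rule extensionalityI[OF _ g])
      fix y assume y: "y \<in> C"
      have "restrict \<sigma> (U y) = g y"
        by (rule extensionalityI[where A = "U y"]) (use y sy gB in auto)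
      then show "(\<lambda>y\<in>C. restrict \<sigma> (U y)) y = g y" using y by simp
    qed simp
    ultimately show ?thesis using sx unfolding C_def U_def by blast
  qed
  show ?thesis
    unfolding bij_betw_def
  proof (intro conjI inj equalityI subsetI)
    fix t assume "t \<in> ?T"
    then obtain \<sigma> where "\<sigma> \<in> B_fun A r rt x n" "t = ?f \<sigma>"
      using surj[of "fst t" "snd t"] by (metis prod.collapse)
    then show "t \<in> ?f ` B_fun A r rt x n" by (rule rev_image_eqI[where f = ?f])
  qed (use into in blast)
qed

theorem theorem5p3:
  fixes A :: "'a set" and r :: "'a rel" and rt x :: 'a and n :: nat
  assumes "arborescence A r rt"
    and "x \<in> A"
  shows "b_num A r rt x n =
    (\<Sum>i = n..rank A r rt x. \<Prod>y | covers A r y x. b_num A r rt y i)"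
proof -
  have fin: "finite A" and po: "partial_order_on A r"
    and acyclic: "\<not> (\<exists>p. graph_cycle A (hasse_edges A r) p)"
    using assms(1) by (auto simp: arborescence_def graph_tree_def)
  have "finite {y. covers A r y x}"
    using fin by (rule rev_finite_subset) (auto simp: covers_def)
  \<comment> \<open>Counting the target of the bijection: the dependent sum gives the sum over
    \<open>i\<close>, and the function space over the finitely many covers gives the
    product.\<close>
  then show ?thesis
    using bij_betw_same_card[OF bij_betw_B_fun[OF fin po acyclic assms(2)], of rt n]
    by (simp add: b_num_def card_PiE finite_PiE finite_B_fun[OF fin])
qed

end
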